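(* Let $(A,[\cdot,\cdot],[\![\cdot,\cdot,\cdot]\!],\alpha)$ be a Hom-Lie-Yamaguti algebra, $(V,\rho,\theta,\beta)$ a representation of it, $(\mathcal F,\mathcal G)$ a $(2,3)$-cocycle with coefficients in $(V,\rho,\theta,\beta)$, and $T:V\to A$ an $(\mathcal F,\mathcal G)$-twisted $\mathcal O$-operator. Then the operations $$u\circ v=\rho(Tu)v,\quad u\curlyvee v=\mathcal F(Tu,Tv),\quad \{u,v,w\}=\theta(Tv,Tw)u,\quad [u,v,w]=\mathcal G(Tu,Tv,Tw),\qquad u,v,w\in V,$$ together with the linear map $\beta$, define an NS-Hom-Lie-Yamaguti algebra structure on $V$ (called the induced NS-Hom-Lie-Yamaguti algebra).
   Context: All linear spaces are finite-dimensional over a field $\mathbb K$ of characteristic $0$. $\circlearrowleft_{x,y,z}$ denotes the sum over cyclic permutations of $(x,y,z)$. A Hom-Lie-Yamaguti algebra $(A,[\cdot,\cdot],[\![\cdot,\cdot,\cdot]\!],\alpha)$ is a linear space $A$ with a linear map $\alpha:A\to A$, a bilinear bracket and a trilinear bracket such that for all $x,y,z,w,t\in A$: (1) $[x,y]=-[y,x]$ and $[\![x,y,z]\!]=-[\![y,x,z]\!]$; (2) $\circlearrowleft_{x,y,z}[[x,y],\alpha(z)]+\circlearrowleft_{x,y,z}[\![x,y,z]\!]=0$; (3) $\circlearrowleft_{x,y,z}[\![[x,y],\alpha(z),\alpha(w)]\!]=0$; (4) $[\![\alpha(x),\alpha(y),[z,w]]\!]=[[\![x,y,z]\!],\alpha^2(w)]+[\alpha^2(z),[\![x,y,w]\!]]$;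 (5) $[\![\alpha^2(x),\alpha^2(y),[\![z,w,t]\!]]\!]=[\![[\![x,y,z]\!],\alpha^2(w),\alpha^2(t)]\!]+[\![\alpha^2(z),[\![x,y,w]\!],\alpha^2(t)]\!]+[\![\alpha^2(z),\alpha^2(w),[\![x,y,t]\!]]\!]$. Representation $(V,\rho,\theta,\beta)$ on $(V,\beta)$ ($\beta:V\to V$ linear): a linear map $\rho:A\to \mathfrak{gl}(V)$ and a bilinear map $\theta:A\times A\to \mathfrak{gl}(V)$ such that, with $D(x,y):=\theta(y,x)-\theta(x,y)+\rho(\alpha(x))\rho(y)-\rho(\alpha(y))\rho(x)-\rho([x,y])\beta$, for all elements of $A$: (R1) $\rho(\alpha(x_1))\beta=\beta\rho(x_1)$, $\theta(\alpha(x_1),\alpha(x_2))\beta=\beta\theta(x_1,x_2)$; (R2) $D([x_1,x_2],\alpha(x_3))+D([x_2,x_3],\alpha(x_1))+D([x_3,x_1],\alpha(x_2))=0$; (R3) $\theta([x_1,x_2],\alpha(y_1))\beta=\theta(\alpha(x_1),\alpha(y_1))\rho(x_2)-\theta(\alpha(x_2),\alpha(y_1))\rho(x_1)$; (R4) $D(\alpha(x_1),\alpha(x_2))\rho(y_2)=\rho(\alpha^2(y_2))D(x_1,x_2)+\rho([\![x_1,x_2,y_2]\!])\beta^2$; (R5) $\theta(\alpha(x_1),[y_1,y_2])\beta=\rho(\alpha^2(y_1))\theta(x_1,y_2)-\rho(\alpha^2(y_2))\theta(x_1,y_1)$; (R6) $D(\alpha^2(x_1),\alpha^2(x_2))\theta(y_1,y_2)=\theta(\alpha^2(y_1),\alpha^2(y_2))D(x_1,x_2)+\theta([\![x_1,x_2,y_1]\!],\alpha^2(y_2))\beta^2+\theta(\alpha^2(y_1),[\![x_1,x_2,y_2]\!])\beta^2$;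 (R7) $\theta(\alpha^2(x_1),[\![y_1,y_2,y_3]\!])\beta^2=\theta(\alpha^2(y_2),\alpha^2(y_3))\theta(x_1,y_1)-\theta(\alpha^2(y_1),\alpha^2(y_3))\theta(x_1,y_2)+D(\alpha^2(y_1),\alpha^2(y_2))\theta(x_1,y_3)$. A $(2,3)$-cocycle with coefficients in $(V,\rho,\theta,\beta)$: a pair $(\mathcal F,\mathcal G)$ with $\mathcal F:A\times A\to V$ bilinear skew-symmetric, $\mathcal G:A\times A\times A\to V$ trilinear and skew-symmetric in its first two arguments, $\mathcal F(\alpha(x),\alpha(y))=\beta\mathcal F(x,y)$, $\mathcal G(\alpha(x),\alpha(y),\alpha(z))=\beta\mathcal G(x,y,z)$, and (C1) $\circlearrowleft_{x,y,z}\big(\mathcal F([x,y],\alpha(z))-\rho(\alpha(x))\mathcal F(y,z)+\mathcal G(x,y,z)\big)=0$; (C2) $\circlearrowleft_{x,y,z}\big(\theta(\alpha(x),\alpha(t))\mathcal F(y,z)+\mathcal G([x,y],\alpha(z),\alpha(t))\big)=0$; (C3) $D(\alpha(x),\alpha(y))\mathcal F(z,t)+\rho(\alpha^2(t))\mathcal G(x,y,z)-\mathcal F([\![x,y,z]\!],\alpha^2(t))+\mathcal G(\alpha(x),\alpha(y),[z,t])-\rho(\alpha^2(z))\mathcal G(x,y,t)-\mathcal F(\alpha^2(z),[\![x,y,t]\!])=0$; (C4) $\theta(\alpha^2(x_4),\alpha^2(z))\mathcal G(x_1,x_2,x_3)-\theta(\alpha^2(x_3),\alpha^2(z))\mathcal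 G(x_1,x_2,x_4)+D(\alpha^2(x_1),\alpha^2(x_2))\mathcal G(x_3,x_4,z)-D(\alpha^2(x_3),\alpha^2(x_4))\mathcal G(x_1,x_2,z)-\mathcal G([\![x_1,x_2,x_3]\!],\alpha^2(x_4),\alpha^2(z))-\mathcal G(\alpha^2(x_3),[\![x_1,x_2,x_4]\!],\alpha^2(z))+\mathcal G(\alpha^2(x_1),\alpha^2(x_2),[\![x_3,x_4,z]\!])-\mathcal G(\alpha^2(x_3),\alpha^2(x_4),[\![x_1,x_2,z]\!])=0$. An $(\mathcal F,\mathcal G)$-twisted $\mathcal O$-operator is a linear map $T:V\to A$ such that for all $u,v,w\in V$: $T\beta=\alpha T$; $[Tu,Tv]=T\big(\rho(Tu)v-\rho(Tv)u+\mathcal F(Tu,Tv)\big)$; $[\![Tu,Tv,Tw]\!]=T\big(D(Tu,Tv)w+\theta(Tv,Tw)u-\theta(Tu,Tw)v+\mathcal G(Tu,Tv,Tw)\big)$. An NS-Hom-Lie-Yamaguti algebra $(A,\circ,\{\cdot,\cdot,\cdot\},\curlyvee,[\cdot,\cdot,\cdot],\alpha)$ is a linear space $A$ with bilinear operations $\circ,\curlyvee$ ($\curlyvee$ skew-symmetric), trilinear operations $\{\cdot,\cdot,\cdot\}$, $[\cdot,\cdot,\cdot]$, and a linear map $\alpha:A\to A$ such that, with $[x_1,x_2]^*=x_1\circ x_2-x_2\circ x_1+x_1\curlyvee x_2$, $\{x_1,x_2,x_3\}^{\wedge}=\{x_3,x_2,x_1\}-\{x_3,x_1,x_2\}+\alpha(x_1)\circ(x_2\circ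 x_3)-\alpha(x_2)\circ(x_1\circ x_3)-[x_1,x_2]^*\circ\alpha(x_3)$, $[\![x_1,x_2,x_3]\!]=\{x_1,x_2,x_3\}^{\wedge}+\{x_1,x_2,x_3\}-\{x_2,x_1,x_3\}+[x_1,x_2,x_3]$, for all $x_1,\dots,x_5\in A$: (N1) $\circlearrowleft_{x_1,x_2,x_3}\big([x_1,x_2]^*\curlyvee\alpha(x_3)-\alpha(x_1)\circ(x_2\curlyvee x_3)+[x_1,x_2,x_3]\big)=0$; (N2) $\circlearrowleft_{x_1,x_2,x_3}\big(\{x_2\curlyvee x_3,\alpha(x_1),\alpha(x_4)\}+[[x_1,x_2]^*,\alpha(x_3),\alpha(x_4)]\big)=0$; (N3) $\circlearrowleft_{x_1,x_2,x_3}\{[x_1,x_2]^*,\alpha(x_3),\alpha(x_4)\}^\wedge=0$; (N4) $\{\alpha(x_4),[x_1,x_2]^*,\alpha(x_3)\}=\{x_2\circ x_4,\alpha(x_1),\alpha(x_3)\}-\{x_1\circ x_4,\alpha(x_2),\alpha(x_3)\}$; (N5) $\{\alpha(x_1),\alpha(x_2),x_3\circ x_4\}^\wedge=\alpha^2(x_3)\circ\{x_1,x_2,x_4\}^\wedge+[\![x_1,x_2,x_3]\!]\circ\alpha^2(x_4)$; (N6) $\{\alpha(x_4),\alpha(x_1),[x_2,x_3]^*\}=\alpha^2(x_2)\circ\{x_4,x_1,x_3\}-\alpha^2(x_3)\circ\{x_4,x_1,x_2\}$; (N7) $\{\alpha^2(x_1),\alpha^2(x_2),\{x_5,x_3,x_4\}\}^\wedge=\{\{x_1,x_2,x_5\}^\wedge,\alpha^2(x_3),\alpha^2(x_4)\}+\{\alpha^2(x_5),[\![x_1,x_2,x_3]\!],\alpha^2(x_4)\}+\{\alpha^2(x_5),\alpha^2(x_3),[\![x_1,x_2,x_4]\!]\}$;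 (N8) $\{\alpha^2(x_5),\alpha^2(x_1),[\![x_2,x_3,x_4]\!]\}=\{\{x_5,x_1,x_2\},\alpha^2(x_3),\alpha^2(x_4)\}-\{\{x_5,x_1,x_3\},\alpha^2(x_2),\alpha^2(x_4)\}+\{\alpha^2(x_2),\alpha^2(x_3),\{x_5,x_1,x_4\}\}^\wedge$; (N9) $\{\alpha(x_1),\alpha(x_2),x_3\curlyvee x_4\}^\wedge+\alpha^2(x_4)\circ[x_1,x_2,x_3]-[\![x_1,x_2,x_3]\!]\curlyvee\alpha^2(x_4)+[\alpha(x_1),\alpha(x_2),[x_3,x_4]^*]-\alpha^2(x_3)\circ[x_1,x_2,x_4]-\alpha^2(x_3)\curlyvee[\![x_1,x_2,x_4]\!]=0$; (N10) $\{[x_1,x_2,x_3],\alpha^2(x_4),\alpha^2(x_5)\}-\{[x_1,x_2,x_4],\alpha^2(x_3),\alpha^2(x_5)\}+\{\alpha^2(x_1),\alpha^2(x_2),[x_3,x_4,x_5]\}^\wedge-\{\alpha^2(x_3),\alpha^2(x_4),[x_1,x_2,x_5]\}^\wedge-[[\![x_1,x_2,x_3]\!],\alpha^2(x_4),\alpha^2(x_5)]-[\alpha^2(x_3),[\![x_1,x_2,x_4]\!],\alpha^2(x_5)]+[\alpha^2(x_1),\alpha^2(x_2),[\![x_3,x_4,x_5]\!]]-[\alpha^2(x_3),\alpha^2(x_4),[\![x_1,x_2,x_5]\!]]=0$. *)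

theory Defs
  imports Complex_Main
begin

locale fin_dim_space = vector_space scale
  for scale :: "'k::field_char_0 \<Rightarrow> 'a::ab_group_add \<Rightarrow> 'a" +
  assumes fin_dim: "\<exists>B. finite_dimensional_vector_space scale B"

definition bilinear_map ::
  "('k::field \<Rightarrow> 'a::ab_group_add \<Rightarrow> 'a) \<Rightarrow> ('k \<Rightarrow> 'b::ab_group_add \<Rightarrow> 'b) \<Rightarrow>
   ('k \<Rightarrow> 'c::ab_group_add \<Rightarrow> 'c) \<Rightarrow> ('a \<Rightarrow> 'b \<Rightarrow> 'c) \<Rightarrow> bool" where
  "bilinear_map sa sb sc f \<longleftrightarrow>
     (\<forall>y. Vector_Spaces.linear sa sc (\<lambda>x. f x y)) \<and>
     (\<forall>x. Vector_Spaces.linear sb sc (\<lambda>y. f x y))"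

definition trilinear_map ::
  "('k::field \<Rightarrow> 'a::ab_group_add \<Rightarrow> 'a) \<Rightarrow> ('k \<Rightarrow> 'b::ab_group_add \<Rightarrow> 'b) \<Rightarrow>
   ('k \<Rightarrow> 'c::ab_group_add \<Rightarrow> 'c) \<Rightarrow> ('k \<Rightarrow> 'd::ab_group_add \<Rightarrow> 'd) \<Rightarrow>
   ('a \<Rightarrow> 'b \<Rightarrow> 'c \<Rightarrow> 'd) \<Rightarrow> bool" where
  "trilinear_map sa sb sc sd f \<longleftrightarrow>
     (\<forall>y z. Vector_Spaces.linear sa sd (\<lambda>x. f x y z)) \<and>
     (\<forall>x z. Vector_Spaces.linear sb sd (\<lambda>y. f x y z)) \<and>
     (\<forall>x y. Vector_Spaces.linear sc sd (\<lambda>z. f x y z))"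

definition cyclic_sum :: "('a \<Rightarrow> 'a \<Rightarrow> 'a \<Rightarrow> 'b::ab_group_add) \<Rightarrow> 'a \<Rightarrow> 'a \<Rightarrow> 'a \<Rightarrow> 'b" where
  "cyclic_sum f x y z = f x y z + f y z x + f z x y"

locale hom_lie_yamaguti = fin_dim_space sA
  for sA :: "'k::field_char_0 \<Rightarrow> 'a::ab_group_add \<Rightarrow> 'a" +
  fixes br :: "'a \<Rightarrow> 'a \<Rightarrow> 'a"
    and tr :: "'a \<Rightarrow> 'a \<Rightarrow> 'a \<Rightarrow> 'a"
    and \<alpha> :: "'a \<Rightarrow> 'a"
  assumes linear_\<alpha>: "Vector_Spaces.linear sA sA \<alpha>"
    and bilinear_br: "bilinear_map sA sA sA br"
    and trilinear_tr: "trilinear_map sA sA sA sA tr"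
    and HLY1: "br x y = - br y x" "tr x y z = - tr y x z"
    and HLY2: "cyclic_sum (\<lambda>x y z. br (br x y) (\<alpha> z)) x y z + cyclic_sum tr x y z = 0"
    and HLY3: "cyclic_sum (\<lambda>x y z. tr (br x y) (\<alpha> z) (\<alpha> w)) x y z = 0"
    and HLY4: "tr (\<alpha> x) (\<alpha> y) (br z w)
      = br (tr x y z) (\<alpha> (\<alpha> w)) + br (\<alpha> (\<alpha> z)) (tr x y w)"
    and HLY5: "tr (\<alpha> (\<alpha> x)) (\<alpha> (\<alpha> y)) (tr z w t)
      = tr (tr x y z) (\<alpha> (\<alpha> w)) (\<alpha> (\<alpha> t))
        + tr (\<alpha> (\<alpha> z)) (tr x y w) (\<alpha> (\<alpha> t))
        + tr (\<alpha> (\<alpha> z)) (\<alpha> (\<alpha> w)) (tr x y t)"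

definition rep_D ::
  "('a \<Rightarrow> 'a \<Rightarrow> 'a) \<Rightarrow> ('a \<Rightarrow> 'a) \<Rightarrow> ('a \<Rightarrow> 'v \<Rightarrow> 'v) \<Rightarrow> ('a \<Rightarrow> 'a \<Rightarrow> 'v \<Rightarrow> 'v) \<Rightarrow> ('v \<Rightarrow> 'v) \<Rightarrow>
   'a \<Rightarrow> 'a \<Rightarrow> 'v::ab_group_add \<Rightarrow> 'v" where
  "rep_D br \<alpha> \<rho> \<theta> \<beta> x y v =
     \<theta> y x v - \<theta> x y v + \<rho> (\<alpha> x) (\<rho> y v) - \<rho> (\<alpha> y) (\<rho> x v) - \<rho> (br x y) (\<beta> v)"

text \<open>Endomorphisms of \<open>V\<close> are functions \<open>'v \<Rightarrow> 'v\<close> that are linear; the vector space structure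
  of \<open>gl(V)\<close> and equations between endomorphisms are spelled out pointwise.\<close>

locale hly_representation = hom_lie_yamaguti sA br tr \<alpha> + V: fin_dim_space sV
  for sA :: "'k::field_char_0 \<Rightarrow> 'a::ab_group_add \<Rightarrow> 'a"
    and br :: "'a \<Rightarrow> 'a \<Rightarrow> 'a"
    and tr :: "'a \<Rightarrow> 'a \<Rightarrow> 'a \<Rightarrow> 'a"
    and \<alpha> :: "'a \<Rightarrow> 'a"
    and sV :: "'k \<Rightarrow> 'v::ab_group_add \<Rightarrow> 'v" +
  fixes \<rho> :: "'a \<Rightarrow> 'v \<Rightarrow> 'v"
    and \<theta> :: "'a \<Rightarrow> 'a \<Rightarrow> 'v \<Rightarrow> 'v"
    and \<beta> :: "'v \<Rightarrow> 'v"
  assumes linear_\<beta>: "Vector_Spaces.linear sV sV \<beta>"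
    and \<rho>_gl: "Vector_Spaces.linear sV sV (\<rho> x)"
    and linear_\<rho>: "Vector_Spaces.linear sA sV (\<lambda>x. \<rho> x v)"
    and \<theta>_gl: "Vector_Spaces.linear sV sV (\<theta> x y)"
    and bilinear_\<theta>: "bilinear_map sA sA sV (\<lambda>x y. \<theta> x y v)"
    and R1: "\<rho> (\<alpha> x1) (\<beta> v) = \<beta> (\<rho> x1 v)"
            "\<theta> (\<alpha> x1) (\<alpha> x2) (\<beta> v) = \<beta> (\<theta> x1 x2 v)"
    and R2: "rep_D br \<alpha> \<rho> \<theta> \<beta> (br x1 x2) (\<alpha> x3) v
      + rep_D br \<alpha> \<rho> \<theta> \<beta> (br x2 x3) (\<alpha> x1) v
      + rep_D br \<alpha> \<rho> \<theta> \<beta> (br x3 x1) (\<alpha> x2) v = 0"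
    and R3: "\<theta> (br x1 x2) (\<alpha> y1) (\<beta> v)
      = \<theta> (\<alpha> x1) (\<alpha> y1) (\<rho> x2 v) - \<theta> (\<alpha> x2) (\<alpha> y1) (\<rho> x1 v)"
    and R4: "rep_D br \<alpha> \<rho> \<theta> \<beta> (\<alpha> x1) (\<alpha> x2) (\<rho> y2 v)
      = \<rho> (\<alpha> (\<alpha> y2)) (rep_D br \<alpha> \<rho> \<theta> \<beta> x1 x2 v) + \<rho> (tr x1 x2 y2) (\<beta> (\<beta> v))"
    and R5: "\<theta> (\<alpha> x1) (br y1 y2) (\<beta> v)
      = \<rho> (\<alpha> (\<alpha> y1)) (\<theta> x1 y2 v) - \<rho> (\<alpha> (\<alpha> y2)) (\<theta> x1 y1 v)"
    and R6: "rep_D br \<alpha> \<rho> \<theta> \<beta> (\<alpha> (\<alpha> x1)) (\<alpha> (\<alpha> x2)) (\<theta> y1 y2 v)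
      = \<theta> (\<alpha> (\<alpha> y1)) (\<alpha> (\<alpha> y2)) (rep_D br \<alpha> \<rho> \<theta> \<beta> x1 x2 v)
        + \<theta> (tr x1 x2 y1) (\<alpha> (\<alpha> y2)) (\<beta> (\<beta> v))
        + \<theta> (\<alpha> (\<alpha> y1)) (tr x1 x2 y2) (\<beta> (\<beta> v))"
    and R7: "\<theta> (\<alpha> (\<alpha> x1)) (tr y1 y2 y3) (\<beta> (\<beta> v))
      = \<theta> (\<alpha> (\<alpha> y2)) (\<alpha> (\<alpha> y3)) (\<theta> x1 y1 v)
        - \<theta> (\<alpha> (\<alpha> y1)) (\<alpha> (\<alpha> y3)) (\<theta> x1 y2 v)
        + rep_D br \<alpha> \<rho> \<theta> \<beta> (\<alpha> (\<alpha> y1)) (\<alpha> (\<alpha> y2)) (\<theta> x1 y3 v)"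
begin

abbreviation D :: "'a \<Rightarrow> 'a \<Rightarrow> 'v \<Rightarrow> 'v" where
  "D \<equiv> rep_D br \<alpha> \<rho> \<theta> \<beta>"

end

locale hly_cocycle = hly_representation sA br tr \<alpha> sV \<rho> \<theta> \<beta>
  for sA :: "'k::field_char_0 \<Rightarrow> 'a::ab_group_add \<Rightarrow> 'a"
    and br :: "'a \<Rightarrow> 'a \<Rightarrow> 'a"
    and tr :: "'a \<Rightarrow> 'a \<Rightarrow> 'a \<Rightarrow> 'a"
    and \<alpha> :: "'a \<Rightarrow> 'a"
    and sV :: "'k \<Rightarrow> 'v::ab_group_add \<Rightarrow> 'v"
    and \<rho> :: "'a \<Rightarrow> 'v \<Rightarrow> 'v"
    and \<theta> :: "'a \<Rightarrow> 'a \<Rightarrow> 'v \<Rightarrow> 'v"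
    and \<beta> :: "'v \<Rightarrow> 'v" +
  fixes F :: "'a \<Rightarrow> 'a \<Rightarrow> 'v"
    and G :: "'a \<Rightarrow> 'a \<Rightarrow> 'a \<Rightarrow> 'v"
  assumes bilinear_F: "bilinear_map sA sA sV F"
    and trilinear_G: "trilinear_map sA sA sA sV G"
    and skew_F: "F x y = - F y x"
    and skew_G: "G x y z = - G y x z"
    and F_\<alpha>: "F (\<alpha> x) (\<alpha> y) = \<beta> (F x y)"
    and G_\<alpha>: "G (\<alpha> x) (\<alpha> y) (\<alpha> z) = \<beta> (G x y z)"
    and C1: "cyclic_sum (\<lambda>x y z. F (br x y) (\<alpha> z) - \<rho> (\<alpha> x) (F y z) + G x y z) x y z = 0"
    and C2: "cyclic_sum (\<lambda>x y z. \<theta> (\<alpha> x) (\<alpha> t) (F y z) + G (br x y) (\<alpha> z) (\<alpha> t)) x y z = 0"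
    and C3: "D (\<alpha> x) (\<alpha> y) (F z t) + \<rho> (\<alpha> (\<alpha> t)) (G x y z) - F (tr x y z) (\<alpha> (\<alpha> t))
      + G (\<alpha> x) (\<alpha> y) (br z t) - \<rho> (\<alpha> (\<alpha> z)) (G x y t) - F (\<alpha> (\<alpha> z)) (tr x y t) = 0"
    and C4: "\<theta> (\<alpha> (\<alpha> x4)) (\<alpha> (\<alpha> z)) (G x1 x2 x3)
      - \<theta> (\<alpha> (\<alpha> x3)) (\<alpha> (\<alpha> z)) (G x1 x2 x4)
      + D (\<alpha> (\<alpha> x1)) (\<alpha> (\<alpha> x2)) (G x3 x4 z)
      - D (\<alpha> (\<alpha> x3)) (\<alpha> (\<alpha> x4)) (G x1 x2 z)
      - G (tr x1 x2 x3) (\<alpha> (\<alpha> x4)) (\<alpha> (\<alpha> z))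
      - G (\<alpha> (\<alpha> x3)) (tr x1 x2 x4) (\<alpha> (\<alpha> z))
      + G (\<alpha> (\<alpha> x1)) (\<alpha> (\<alpha> x2)) (tr x3 x4 z)
      - G (\<alpha> (\<alpha> x3)) (\<alpha> (\<alpha> x4)) (tr x1 x2 z) = 0"

locale twisted_O_operator = hly_cocycle sA br tr \<alpha> sV \<rho> \<theta> \<beta> F G
  for sA :: "'k::field_char_0 \<Rightarrow> 'a::ab_group_add \<Rightarrow> 'a"
    and br :: "'a \<Rightarrow> 'a \<Rightarrow> 'a"
    and tr :: "'a \<Rightarrow> 'a \<Rightarrow> 'a \<Rightarrow> 'a"
    and \<alpha> :: "'a \<Rightarrow> 'a"
    and sV :: "'k \<Rightarrow> 'v::ab_group_add \<Rightarrow> 'v"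
    and \<rho> :: "'a \<Rightarrow> 'v \<Rightarrow> 'v"
    and \<theta> :: "'a \<Rightarrow> 'a \<Rightarrow> 'v \<Rightarrow> 'v"
    and \<beta> :: "'v \<Rightarrow> 'v"
    and F :: "'a \<Rightarrow> 'a \<Rightarrow> 'v"
    and G :: "'a \<Rightarrow> 'a \<Rightarrow> 'a \<Rightarrow> 'v" +
  fixes T :: "'v \<Rightarrow> 'a"
  assumes linear_T: "Vector_Spaces.linear sV sA T"
    and T_\<beta>: "T (\<beta> u) = \<alpha> (T u)"
    and T_br: "br (T u) (T v) = T (\<rho> (T u) v - \<rho> (T v) u + F (T u) (T v))"
    and T_tr: "tr (T u) (T v) (T w)
      = T (D (T u) (T v) w + \<theta> (T v) (T w) u - \<theta> (T u) (T w) v + G (T u) (T v) (T w))"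

text \<open>In the following, \<open>tri x y z\<close> and \<open>sq x y z\<close> stand for the operations written
  \<open>{x, y, z}\<close> and \<open>[x, y, z]\<close>; the derived operations \<open>star\<close>, \<open>hat\<close> and \<open>dbl\<close> are
  \<open>[x, y]\<^sup>*\<close>, \<open>{x, y, z}\<^sup>\<and>\<close> and the double bracket.\<close>

locale ns_operations =
  fixes circ :: "'a::ab_group_add \<Rightarrow> 'a \<Rightarrow> 'a"  (infixl \<open>\<odot>\<close> 70)
    and tri :: "'a \<Rightarrow> 'a \<Rightarrow> 'a \<Rightarrow> 'a"
    and vee :: "'a \<Rightarrow> 'a \<Rightarrow> 'a"  (infixl \<open>\<Ydown>\<close> 70)
    and sq :: "'a \<Rightarrow> 'a \<Rightarrow> 'a \<Rightarrow> 'a"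
    and \<alpha> :: "'a \<Rightarrow> 'a"
begin

definition star :: "'a \<Rightarrow> 'a \<Rightarrow> 'a" where
  "star x1 x2 = x1 \<odot> x2 - x2 \<odot> x1 + x1 \<Ydown> x2"

definition hat :: "'a \<Rightarrow> 'a \<Rightarrow> 'a \<Rightarrow> 'a" where
  "hat x1 x2 x3 = tri x3 x2 x1 - tri x3 x1 x2
     + \<alpha> x1 \<odot> (x2 \<odot> x3) - \<alpha> x2 \<odot> (x1 \<odot> x3) - star x1 x2 \<odot> \<alpha> x3"

definition dbl :: "'a \<Rightarrow> 'a \<Rightarrow> 'a \<Rightarrow> 'a" where
  "dbl x1 x2 x3 = hat x1 x2 x3 + tri x1 x2 x3 - tri x2 x1 x3 + sq x1 x2 x3"

end

locale ns_hom_lie_yamaguti = fin_dim_space sA + ns_operations circ tri vee sq \<alpha>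
  for sA :: "'k::field_char_0 \<Rightarrow> 'a::ab_group_add \<Rightarrow> 'a"
    and circ :: "'a \<Rightarrow> 'a \<Rightarrow> 'a"  (infixl \<open>\<odot>\<close> 70)
    and tri :: "'a \<Rightarrow> 'a \<Rightarrow> 'a \<Rightarrow> 'a"
    and vee :: "'a \<Rightarrow> 'a \<Rightarrow> 'a"  (infixl \<open>\<Ydown>\<close> 70)
    and sq :: "'a \<Rightarrow> 'a \<Rightarrow> 'a \<Rightarrow> 'a"
    and \<alpha> :: "'a \<Rightarrow> 'a" +
  assumes linear_\<alpha>: "Vector_Spaces.linear sA sA \<alpha>"
    and bilinear_circ: "bilinear_map sA sA sA circ"
    and bilinear_vee: "bilinear_map sA sA sA vee"
    and skew_vee: "x \<Ydown> y = - (y \<Ydown> x)"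
    and trilinear_tri: "trilinear_map sA sA sA sA tri"
    and trilinear_sq: "trilinear_map sA sA sA sA sq"
    and N1: "cyclic_sum (\<lambda>x1 x2 x3. star x1 x2 \<Ydown> \<alpha> x3 - \<alpha> x1 \<odot> (x2 \<Ydown> x3) + sq x1 x2 x3)
      x1 x2 x3 = 0"
    and N2: "cyclic_sum (\<lambda>x1 x2 x3. tri (x2 \<Ydown> x3) (\<alpha> x1) (\<alpha> x4)
      + sq (star x1 x2) (\<alpha> x3) (\<alpha> x4)) x1 x2 x3 = 0"
    and N3: "cyclic_sum (\<lambda>x1 x2 x3. hat (star x1 x2) (\<alpha> x3) (\<alpha> x4)) x1 x2 x3 = 0"
    and N4: "tri (\<alpha> x4) (star x1 x2) (\<alpha> x3)
      = tri (x2 \<odot> x4) (\<alpha> x1) (\<alpha> x3) - tri (x1 \<odot> x4) (\<alpha> x2) (\<alpha> x3)"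
    and N5: "hat (\<alpha> x1) (\<alpha> x2) (x3 \<odot> x4)
      = \<alpha> (\<alpha> x3) \<odot> hat x1 x2 x4 + dbl x1 x2 x3 \<odot> \<alpha> (\<alpha> x4)"
    and N6: "tri (\<alpha> x4) (\<alpha> x1) (star x2 x3)
      = \<alpha> (\<alpha> x2) \<odot> tri x4 x1 x3 - \<alpha> (\<alpha> x3) \<odot> tri x4 x1 x2"
    and N7: "hat (\<alpha> (\<alpha> x1)) (\<alpha> (\<alpha> x2)) (tri x5 x3 x4)
      = tri (hat x1 x2 x5) (\<alpha> (\<alpha> x3)) (\<alpha> (\<alpha> x4))
        + tri (\<alpha> (\<alpha> x5)) (dbl x1 x2 x3) (\<alpha> (\<alpha> x4))
        + tri (\<alpha> (\<alpha> x5)) (\<alpha> (\<alpha> x3)) (dbl x1 x2 x4)"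
    and N8: "tri (\<alpha> (\<alpha> x5)) (\<alpha> (\<alpha> x1)) (dbl x2 x3 x4)
      = tri (tri x5 x1 x2) (\<alpha> (\<alpha> x3)) (\<alpha> (\<alpha> x4))
        - tri (tri x5 x1 x3) (\<alpha> (\<alpha> x2)) (\<alpha> (\<alpha> x4))
        + hat (\<alpha> (\<alpha> x2)) (\<alpha> (\<alpha> x3)) (tri x5 x1 x4)"
    and N9: "hat (\<alpha> x1) (\<alpha> x2) (x3 \<Ydown> x4) + \<alpha> (\<alpha> x4) \<odot> sq x1 x2 x3
      - dbl x1 x2 x3 \<Ydown> \<alpha> (\<alpha> x4) + sq (\<alpha> x1) (\<alpha> x2) (star x3 x4)
      - \<alpha> (\<alpha> x3) \<odot> sq x1 x2 x4 - \<alpha> (\<alpha> x3) \<Ydown> dbl x1 x2 x4 = 0"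
    and N10: "tri (sq x1 x2 x3) (\<alpha> (\<alpha> x4)) (\<alpha> (\<alpha> x5))
      - tri (sq x1 x2 x4) (\<alpha> (\<alpha> x3)) (\<alpha> (\<alpha> x5))
      + hat (\<alpha> (\<alpha> x1)) (\<alpha> (\<alpha> x2)) (sq x3 x4 x5)
      - hat (\<alpha> (\<alpha> x3)) (\<alpha> (\<alpha> x4)) (sq x1 x2 x5)
      - sq (dbl x1 x2 x3) (\<alpha> (\<alpha> x4)) (\<alpha> (\<alpha> x5))
      - sq (\<alpha> (\<alpha> x3)) (dbl x1 x2 x4) (\<alpha> (\<alpha> x5))
      + sq (\<alpha> (\<alpha> x1)) (\<alpha> (\<alpha> x2)) (dbl x3 x4 x5)
      - sq (\<alpha> (\<alpha> x3)) (\<alpha> (\<alpha> x4)) (dbl x1 x2 x5) = 0"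

end

theory Submission
  imports Defs
begin

text \<open>The twisted O-operator identities say that \<open>T\<close> carries the derived operations
  \<open>[u, v]\<^sup>*\<close> and the double bracket on \<open>V\<close> to the binary and ternary brackets of \<open>A\<close>, and then
  \<open>{u, v, w}\<^sup>\<and>\<close> equals \<open>D (T u) (T v) w\<close>. Hence each of the identities (N1)--(N10) is an
  identity of the representation or of the cocycle, evaluated on the image of \<open>T\<close>.\<close>

lemma bilinear_map_compose:
  assumes h: "bilinear_map t\<^sub>1 t\<^sub>2 t h"
    and f: "Vector_Spaces.linear s\<^sub>1 t\<^sub>1 f"
    and g: "Vector_Spaces.linear s\<^sub>2 t\<^sub>2 g"
  shows "bilinear_map s\<^sub>1 s\<^sub>2 t (\<lambda>x y. h (f x) (g y))"
  using h Vector_Spaces.linear_compose[OF f, of t "\<lambda>x. h x (g y)" for y]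
    Vector_Spaces.linear_compose[OF g, of t "h (f x)" for x]
  by (simp add: bilinear_map_def o_def)

lemma trilinear_map_compose:
  assumes h: "trilinear_map t\<^sub>1 t\<^sub>2 t\<^sub>3 t h"
    and f: "Vector_Spaces.linear s\<^sub>1 t\<^sub>1 f"
    and g: "Vector_Spaces.linear s\<^sub>2 t\<^sub>2 g"
    and k: "Vector_Spaces.linear s\<^sub>3 t\<^sub>3 k"
  shows "trilinear_map s\<^sub>1 s\<^sub>2 s\<^sub>3 t (\<lambda>x y z. h (f x) (g y) (k z))"
  using h Vector_Spaces.linear_compose[OF f, of t "\<lambda>x. h x (g y) (k z)" for y z]
    Vector_Spaces.linear_compose[OF g, of t "\<lambda>y. h (f x) y (k z)" for x z]
    Vector_Spaces.linear_compose[OF k, of t "h (f x) (g y)" for x y]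
  by (simp add: trilinear_map_def o_def)

context hly_representation
begin

lemma bilinear_\<rho>: "bilinear_map sA sV sV \<rho>"
  using linear_\<rho> \<rho>_gl by (simp add: bilinear_map_def)

lemma trilinear_\<theta>: "trilinear_map sV sA sA sV (\<lambda>v x y. \<theta> x y v)"
  using \<theta>_gl bilinear_\<theta> by (simp add: trilinear_map_def bilinear_map_def)

end

context twisted_O_operator
begin

abbreviation circ :: "'v \<Rightarrow> 'v \<Rightarrow> 'v"  (infixl \<open>\<odot>\<close> 70) where
  "u \<odot> v \<equiv> \<rho> (T u) v"

abbreviation vee :: "'v \<Rightarrow> 'v \<Rightarrow> 'v"  (infixl \<open>\<Ydown>\<close> 70) where
  "u \<Ydown> v \<equiv> F (T u) (T v)"

abbreviation tri :: "'v \<Rightarrow> 'v \<Rightarrow> 'v \<Rightarrow> 'v" where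
  "tri u v w \<equiv> \<theta> (T v) (T w) u"

abbreviation sq :: "'v \<Rightarrow> 'v \<Rightarrow> 'v \<Rightarrow> 'v" where
  "sq u v w \<equiv> G (T u) (T v) (T w)"

sublocale ns: ns_operations circ tri vee sq \<beta> .

lemma T_star: "T (ns.star u v) = br (T u) (T v)"
  by (simp add: ns.star_def T_br)

lemma hat_eq_D: "ns.hat u v w = D (T u) (T v) w"
  by (simp add: ns.hat_def rep_D_def T_star T_\<beta>)

lemma T_dbl: "T (ns.dbl u v w) = tr (T u) (T v) (T w)"
  by (simp add: ns.dbl_def hat_eq_D T_tr)

lemmas T_transport = T_\<beta> T_star T_dbl hat_eq_D

lemma bilinear_circ: "bilinear_map sV sV sV circ"
  by (fact bilinear_map_compose[OF bilinear_\<rho> linear_T V.linear_ident])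

lemma bilinear_vee: "bilinear_map sV sV sV vee"
  by (fact bilinear_map_compose[OF bilinear_F linear_T linear_T])

lemma trilinear_tri: "trilinear_map sV sV sV sV tri"
  by (fact trilinear_map_compose[OF trilinear_\<theta> V.linear_ident linear_T linear_T])

lemma trilinear_sq: "trilinear_map sV sV sV sV sq"
  by (fact trilinear_map_compose[OF trilinear_G linear_T linear_T linear_T])

lemma cyclic_sum_star_vee:
  "cyclic_sum (\<lambda>u v w. ns.star u v \<Ydown> \<beta> w - \<beta> u \<odot> (v \<Ydown> w) + sq u v w) u v w = 0"
  using C1 by (simp add: cyclic_sum_def T_transport)

lemma cyclic_sum_tri_vee:
  "cyclic_sum (\<lambda>u v w. tri (v \<Ydown> w) (\<beta> u) (\<beta> t) + sq (ns.star u v) (\<beta> w) (\<beta> t)) u v w = 0"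
  using C2 by (simp add: cyclic_sum_def T_transport)

lemma cyclic_sum_hat_star:
  "cyclic_sum (\<lambda>u v w. ns.hat (ns.star u v) (\<beta> w) (\<beta> t)) u v w = 0"
  using R2 by (simp add: cyclic_sum_def T_transport)

lemma tri_star_middle:
  "tri (\<beta> t) (ns.star u v) (\<beta> w) = tri (v \<odot> t) (\<beta> u) (\<beta> w) - tri (u \<odot> t) (\<beta> v) (\<beta> w)"
  unfolding T_transport by (rule R3)

lemma hat_circ:
  "ns.hat (\<beta> u) (\<beta> v) (w \<odot> t) = \<beta> (\<beta> w) \<odot> ns.hat u v t + ns.dbl u v w \<odot> \<beta> (\<beta> t)"
  unfolding T_transport by (rule R4)

lemma tri_star_right:
  "tri (\<beta> t) (\<beta> u) (ns.star v w) = \<beta> (\<beta> v) \<odot> tri t u w - \<beta> (\<beta> w) \<odot> tri t u v"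
  unfolding T_transport by (rule R5)

lemma hat_tri:
  "ns.hat (\<beta> (\<beta> u)) (\<beta> (\<beta> v)) (tri s w t)
    = tri (ns.hat u v s) (\<beta> (\<beta> w)) (\<beta> (\<beta> t))
      + tri (\<beta> (\<beta> s)) (ns.dbl u v w) (\<beta> (\<beta> t))
      + tri (\<beta> (\<beta> s)) (\<beta> (\<beta> w)) (ns.dbl u v t)"
  unfolding T_transport by (rule R6)

lemma tri_dbl_right:
  "tri (\<beta> (\<beta> s)) (\<beta> (\<beta> u)) (ns.dbl v w t)
    = tri (tri s u v) (\<beta> (\<beta> w)) (\<beta> (\<beta> t))
      - tri (tri s u w) (\<beta> (\<beta> v)) (\<beta> (\<beta> t))
      + ns.hat (\<beta> (\<beta> v)) (\<beta> (\<beta> w)) (tri s u t)"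
  unfolding T_transport by (rule R7)

lemma hat_vee:
  "ns.hat (\<beta> u) (\<beta> v) (w \<Ydown> t) + \<beta> (\<beta> t) \<odot> sq u v w - ns.dbl u v w \<Ydown> \<beta> (\<beta> t)
    + sq (\<beta> u) (\<beta> v) (ns.star w t) - \<beta> (\<beta> w) \<odot> sq u v t - \<beta> (\<beta> w) \<Ydown> ns.dbl u v t = 0"
  unfolding T_transport by (rule C3)

lemma hat_sq:
  "tri (sq u v w) (\<beta> (\<beta> t)) (\<beta> (\<beta> s))
    - tri (sq u v t) (\<beta> (\<beta> w)) (\<beta> (\<beta> s))
    + ns.hat (\<beta> (\<beta> u)) (\<beta> (\<beta> v)) (sq w t s)
    - ns.hat (\<beta> (\<beta> w)) (\<beta> (\<beta> t)) (sq u v s)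
    - sq (ns.dbl u v w) (\<beta> (\<beta> t)) (\<beta> (\<beta> s))
    - sq (\<beta> (\<beta> w)) (ns.dbl u v t) (\<beta> (\<beta> s))
    + sq (\<beta> (\<beta> u)) (\<beta> (\<beta> v)) (ns.dbl w t s)
    - sq (\<beta> (\<beta> w)) (\<beta> (\<beta> t)) (ns.dbl u v s) = 0"
  unfolding T_transport by (rule C4)

sublocale ns: ns_hom_lie_yamaguti sV circ tri vee sq \<beta>
  by (intro ns_hom_lie_yamaguti.intro ns_hom_lie_yamaguti_axioms.intro)
    (fact V.fin_dim_space_axioms linear_\<beta> bilinear_circ bilinear_vee skew_F trilinear_tri
      trilinear_sq cyclic_sum_star_vee cyclic_sum_tri_vee cyclic_sum_hat_star tri_star_middle
      hat_circ tri_star_right hat_tri tri_dbl_right hat_vee hat_sq)+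

end

theorem theorem6p4:
  fixes sA :: "'k::field_char_0 \<Rightarrow> 'a::ab_group_add \<Rightarrow> 'a"
    and br :: "'a \<Rightarrow> 'a \<Rightarrow> 'a"
    and tr :: "'a \<Rightarrow> 'a \<Rightarrow> 'a \<Rightarrow> 'a"
    and \<alpha> :: "'a \<Rightarrow> 'a"
    and sV :: "'k \<Rightarrow> 'v::ab_group_add \<Rightarrow> 'v"
    and \<rho> :: "'a \<Rightarrow> 'v \<Rightarrow> 'v"
    and \<theta> :: "'a \<Rightarrow> 'a \<Rightarrow> 'v \<Rightarrow> 'v"
    and \<beta> :: "'v \<Rightarrow> 'v"
    and F :: "'a \<Rightarrow> 'a \<Rightarrow> 'v"
    and G :: "'a \<Rightarrow> 'a \<Rightarrow> 'a \<Rightarrow> 'v"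
    and T :: "'v \<Rightarrow> 'a"
  assumes "hom_lie_yamaguti sA br tr \<alpha>"
    and "hly_representation sA br tr \<alpha> sV \<rho> \<theta> \<beta>"
    and "hly_cocycle sA br tr \<alpha> sV \<rho> \<theta> \<beta> F G"
    and "twisted_O_operator sA br tr \<alpha> sV \<rho> \<theta> \<beta> F G T"
  shows "ns_hom_lie_yamaguti sV
           (\<lambda>u v. \<rho> (T u) v)
           (\<lambda>u v w. \<theta> (T v) (T w) u)
           (\<lambda>u v. F (T u) (T v))
           (\<lambda>u v w. G (T u) (T v) (T w))
           \<beta>"
proof -
  interpret twisted_O_operator sA br tr \<alpha> sV \<rho> \<theta> \<beta> F G T
    by (rule assms(4))
  show ?thesis
    by (rule ns.ns_hom_lie_yamaguti_axioms)
qed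

end
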